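(* Let $n,k$ be positive integers with $k\le n$ and let $\mathcal{F}$ be a family of $k$-element subsets of $[n]$ with dependency $d$. Then $\beta_{[\pm1]}(\mathcal{F})\le \frac{\sqrt{k}}{c}(\ln(d+1)+1)$, where $c=0.67$.
   Context: For a positive integer $n$, $[n]=\{1,\dots,n\}$. For a set $D$ of integers and families $\mathcal{F},\mathcal{F}'$ of subsets of $[n]$, $\mathcal{F}'$ is called $D$-secting for $\mathcal{F}$ if for every $A\in\mathcal{F}$ there exists $A'\in\mathcal{F}'$ with $|A\cap A'|-|A\cap([n]\setminus A')|\in D$. $\beta_D(\mathcal{F})$ is the minimum cardinality of a $D$-secting family for $\mathcal{F}$; $\beta_{[\pm 1]}$ denotes $\beta_D$ with $D=\{-1,0,1\}$. The dependency of a set $A\in\mathcal{F}$ is the number of sets $\widehat{A}\in\mathcal{F}$ with $\widehat{A}\neq A$ and $|A\cap\widehat{A}|\ge1$; the dependency $d$ of $\mathcal{F}$ is the maximum dependency of a set in $\mathcal{F}$. *)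

theory Defs
  imports Complex_Main
begin

definition secting :: "nat \<Rightarrow> int set \<Rightarrow> nat set set \<Rightarrow> nat set set \<Rightarrow> bool" where
  "secting n D F F' \<longleftrightarrow>
     (\<forall>A\<in>F. \<exists>A'\<in>F'. int (card (A \<inter> A')) - int (card (A \<inter> ({1..n} - A'))) \<in> D)"

text \<open>The minimum is only meaningful if some \<^term>\<open>D\<close>-secting family exists; for
  \<^term>\<open>D = {-1, 0, 1}\<close> this always holds, see \<open>secting_pm1_exists\<close> below.\<close>

definition secting_number :: "nat \<Rightarrow> int set \<Rightarrow> nat set set \<Rightarrow> nat" where
  "secting_number n D F = (LEAST m. \<exists>F'. F' \<subseteq> Pow {1..n} \<and> secting n D F F' \<and> card F' = m)"

definition set_dependency :: "nat set set \<Rightarrow> nat set \<Rightarrow> nat" where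
  "set_dependency F A = card {B \<in> F. B \<noteq> A \<and> card (A \<inter> B) \<ge> 1}"

text \<open>The empty family, for which the maximum is void, gets dependency 0.\<close>

definition dependency :: "nat set set \<Rightarrow> nat" where
  "dependency F = (if F = {} then 0 else Max (set_dependency F ` F))"

lemma secting_pm1_exists:
  assumes "F \<subseteq> Pow {1..n}"
  shows "secting n {-1, 0, 1} F (Pow {1..n})"
  unfolding secting_def
proof
  fix A assume "A \<in> F"
  then have A: "A \<subseteq> {1..n}" "finite A"
    using assms finite_subset[of A "{1..n}"] by auto
  obtain A' where A': "A' \<subseteq> A" "card A' = card A div 2"
    using obtain_subset_with_card_n[of "card A div 2" A] by auto
  have "A \<inter> A' = A'" "A \<inter> ({1..n} - A') = A - A'"
    using A A' by auto
  moreover have "card (A - A') = card A - card A div 2"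
    using A A' by (simp add: card_Diff_subset finite_subset)
  ultimately have "int (card (A \<inter> A')) - int (card (A \<inter> ({1..n} - A'))) \<in> {-1, 0, 1}"
    using A' by auto
  then show "\<exists>A'\<in>Pow {1..n}. int (card (A \<inter> A')) - int (card (A \<inter> ({1..n} - A'))) \<in> {-1, 0, 1}"
    using A A' by blast
qed

end

theory Submission
  imports Defs "HOL-Library.FuncSet"
begin

text \<open>
  Choose \<open>t = \<lfloor>sqrt k / 0.67 * (ln (d + 1) + 1)\<rfloor>\<close> subsets of \<open>[n]\<close> uniformly and independently, and
  let \<open>E\<^sub>A\<close> be the event that none of them splits \<open>A\<close> evenly. A single subset succeeds with
  probability \<open>p\<close>, a central binomial probability, so \<open>E\<^sub>A\<close> has probability \<open>(1 - p)\<^sup>t\<close>, and it is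
  independent of all events \<open>E\<^sub>B\<close> with \<open>B\<close> disjoint from \<open>A\<close>. The symmetric local lemma therefore
  applies once \<open>(1 - p)\<^sup>t \<le> exp (- (ln (d + 1) + 1))\<close>. Since \<open>t\<close> is rounded down, the
  bounds \<open>p \<ge> 0.67 / sqrt k\<close> and \<open>1 - p \<le> exp (- p)\<close> alone do not suffice: for even \<open>k\<close>
  one uses \<open>p \<ge> 0.75 / sqrt k\<close> (for \<open>k \<ge> 4\<close>) and \<open>1 - p \<le> exp (- p - p\<^sup>2 / 2)\<close>. For \<open>d = 0\<close>
  the local lemma only requires \<open>p > 0\<close>.
\<close>

section \<open>The symmetric local lemma for uniform finite spaces\<close>

text \<open>Avoiding the events of \<open>T\<close> one at a time keeps at least a fraction
  \<open>1 - x\<close> of the remaining points at each step. The bound is only asked for index sets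
  between \<open>S\<close> and \<open>S \<union> T\<close> reached along the way, so that an
  induction on the size of the index set can supply it.\<close>

lemma card_avoid_ge:
  fixes E :: "'i \<Rightarrow> 'a set" and x :: real
  assumes "finite \<Omega>" "finite T" "x \<le> 1"
    and "\<And>j S'. j \<in> T \<Longrightarrow> j \<notin> S' \<Longrightarrow> S' \<subseteq> T \<Longrightarrow>
      real (card (E j \<inter> (\<Omega> - \<Union>(E ` (S \<union> S'))))) \<le> x * real (card (\<Omega> - \<Union>(E ` (S \<union> S'))))"
  shows "(1 - x) ^ card T * real (card (\<Omega> - \<Union>(E ` S))) \<le> real (card (\<Omega> - \<Union>(E ` (S \<union> T))))"
  using assms(2,4)
proof (induction T rule: finite_induct)
  case empty
  then show ?case by simp
next
  case (insert j T)
  let ?G = "\<Omega> - \<Union>(E ` (S \<union> T))"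
  have IH: "(1 - x) ^ card T * real (card (\<Omega> - \<Union>(E ` S))) \<le> real (card ?G)"
    by (rule insert.IH) (use insert.prems in blast)
  have step: "real (card (E j \<inter> ?G)) \<le> x * real (card ?G)"
    by (rule insert.prems) (use insert.hyps in auto)
  have "\<Omega> - \<Union>(E ` (S \<union> insert j T)) = ?G - E j \<inter> ?G" by auto
  moreover have "card (?G - E j \<inter> ?G) = card ?G - card (E j \<inter> ?G)"
    using assms(1) by (intro card_Diff_subset) auto
  moreover have "card (E j \<inter> ?G) \<le> card ?G"
    using assms(1) by (intro card_mono) auto
  ultimately have eq: "real (card (\<Omega> - \<Union>(E ` (S \<union> insert j T)))) = real (card ?G) - real (card (E j \<inter> ?G))"
    by (simp add: of_nat_diff)
  have "(1 - x) ^ card (insert j T) * real (card (\<Omega> - \<Union>(E ` S)))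
      = (1 - x) * ((1 - x) ^ card T * real (card (\<Omega> - \<Union>(E ` S))))"
    using insert.hyps by simp
  also have "\<dots> \<le> (1 - x) * real (card ?G)"
    using IH assms(3) by (intro mult_left_mono) auto
  also have "\<dots> \<le> real (card (\<Omega> - \<Union>(E ` (S \<union> insert j T))))"
    unfolding eq using step by (simp add: algebra_simps)
  finally show ?case .
qed

text \<open>The Lovasz local lemma by counting: cardinalities replace probabilities, and
  independence is cross-multiplied so that it stays in the naturals.\<close>

lemma local_lemma_uniform:
  fixes E :: "'i \<Rightarrow> 'a set" and x :: real
  assumes fin: "finite \<Omega>" "finite I" and ne: "\<Omega> \<noteq> {}"
    and x: "0 \<le> x" "x < 1"
    and indep: "\<And>i S. i \<in> I \<Longrightarrow> S \<subseteq> I - insert i (nb i) \<Longrightarrow>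
      card (E i \<inter> (\<Omega> - \<Union>(E ` S))) * card \<Omega> = card (E i) * card (\<Omega> - \<Union>(E ` S))"
    and nb: "\<And>i. i \<in> I \<Longrightarrow> card (I \<inter> nb i) \<le> d"
    and prob: "\<And>i. i \<in> I \<Longrightarrow> real (card (E i)) \<le> x * (1 - x) ^ d * real (card \<Omega>)"
  shows "\<Omega> - \<Union>(E ` I) \<noteq> {}"
proof -
  define G where "G S = \<Omega> - \<Union>(E ` S)" for S
  have finG: "finite (G S)" for S using fin(1) by (simp add: G_def)
  have pos: "real (card \<Omega>) > 0" using fin ne by (simp add: card_gt_0_iff)
  \<comment> \<open>The usual bound \<open>x\<close> on the conditional probability of
    \<open>E i\<close> given that no event of \<open>S\<close> occurs. The product form makes sense
    even if \<open>G S\<close> is empty, which is not yet excluded.\<close>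
  have cond: "real (card (E i \<inter> G S)) \<le> x * real (card (G S))" if "S \<subseteq> I" "i \<in> I" for S i
    using that
  proof (induction "card S" arbitrary: S i rule: less_induct)
    case less
    have finS: "finite S" using less.prems fin finite_subset by blast
    show ?case
    proof (cases "i \<in> S")
      case True
      then have "E i \<inter> G S = {}" by (auto simp: G_def)
      then show ?thesis using x by simp
    next
      case False
      define S1 where "S1 = S \<inter> nb i"
      define S2 where "S2 = S - nb i"
      have S: "S = S2 \<union> S1" by (auto simp: S1_def S2_def)
      have fin12: "finite S1" "finite S2" using finS by (auto simp: S1_def S2_def)
      \<comment> \<open>Independence will handle the non-neighbours \<open>S2\<close>; avoiding the
        at most \<open>d\<close> neighbours in \<open>S1\<close> as well keeps at least a fraction
        \<open>(1 - x) ^ d\<close>, which cancels the same factor in \<open>prob\<close>.\<close>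
      have ge: "(1 - x) ^ card S1 * real (card (G S2)) \<le> real (card (G S))"
        unfolding S G_def
      proof (rule card_avoid_ge[OF fin(1) fin12(1)])
        fix j S' assume j: "j \<in> S1" "j \<notin> S'" "S' \<subseteq> S1"
        \<comment> \<open>The index \<open>j\<close> is missing on the left, so the induction
          hypothesis applies to this smaller set.\<close>
        have "S2 \<union> S' \<subset> S" using j by (auto simp: S1_def S2_def)
        then have "card (S2 \<union> S') < card S" using finS by (rule psubset_card_mono[rotated])
        then show "real (card (E j \<inter> (\<Omega> - \<Union>(E ` (S2 \<union> S'))))) \<le> x * real (card (\<Omega> - \<Union>(E ` (S2 \<union> S'))))"
          using less.hyps[of "S2 \<union> S'" j] less.prems j unfolding G_def S1_def S2_def by blast
      qed (use x in simp)
      have "card S1 \<le> card (I \<inter> nb i)"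
        using fin less.prems by (intro card_mono) (auto simp: S1_def)
      then have c1: "card S1 \<le> d" using nb[OF less.prems(2)] by simp
      have "S2 \<subseteq> I - insert i (nb i)" using False less.prems by (auto simp: S2_def)
      from indep[OF less.prems(2) this]
      have "real (card (E i \<inter> G S2)) * real (card \<Omega>) = real (card (E i)) * real (card (G S2))"
        unfolding G_def by (metis of_nat_mult)
      also have "\<dots> \<le> (x * (1 - x) ^ d * real (card \<Omega>)) * real (card (G S2))"
        by (intro mult_right_mono prob less.prems) auto
      finally have "real (card (E i \<inter> G S2)) * real (card \<Omega>)
          \<le> (x * (1 - x) ^ d * real (card (G S2))) * real (card \<Omega>)"
        by (simp add: mult_ac)
      then have le2: "real (card (E i \<inter> G S2)) \<le> x * (1 - x) ^ d * real (card (G S2))"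
        using pos by (rule mult_right_le_imp_le)
      have "E i \<inter> G S \<subseteq> E i \<inter> G S2" by (auto simp: G_def S2_def)
      then have "real (card (E i \<inter> G S)) \<le> real (card (E i \<inter> G S2))"
        using finG by (simp add: card_mono)
      also note le2
      also have "x * (1 - x) ^ d * real (card (G S2)) \<le> x * ((1 - x) ^ card S1 * real (card (G S2)))"
        unfolding mult.assoc using x c1
        by (intro mult_left_mono mult_right_mono power_decreasing) auto
      also have "\<dots> \<le> x * real (card (G S))"
        using ge x by (intro mult_left_mono) auto
      finally show ?thesis .
    qed
  qed
  have "(1 - x) ^ card I * real (card (\<Omega> - \<Union>(E ` {}))) \<le> real (card (\<Omega> - \<Union>(E ` ({} \<union> I))))"
    using fin x cond by (intro card_avoid_ge) (auto simp: G_def)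
  moreover have "(1 - x) ^ card I * real (card \<Omega>) > 0" using x pos by simp
  ultimately have "0 < card (\<Omega> - \<Union>(E ` I))" by simp
  then show ?thesis by (metis card.empty less_irrefl)
qed

section \<open>Tuples of subsets\<close>

text \<open>Cutting every coordinate along \<open>A\<close> is a bijection onto pairs of tuples,
  with coordinatewise union as inverse. The restrictions to \<open>T\<close> keep the cut tuples
  extensional.\<close>

lemma card_tuples_split:
  assumes "A \<subseteq> V"
  shows "card {x \<in> T \<rightarrow>\<^sub>E Pow V. P (\<lambda>i\<in>T. x i \<inter> A) \<and> Q (\<lambda>i\<in>T. x i - A)}
    = card {y \<in> T \<rightarrow>\<^sub>E Pow A. P y} * card {z \<in> T \<rightarrow>\<^sub>E Pow (V - A). Q z}"
proof -
  let ?f = "\<lambda>x. ((\<lambda>i\<in>T. x i \<inter> A), (\<lambda>i\<in>T. x i - A))"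
  let ?g = "\<lambda>(y, z). (\<lambda>i\<in>T. y i \<union> z i)"
  have "bij_betw ?f {x \<in> T \<rightarrow>\<^sub>E Pow V. P (\<lambda>i\<in>T. x i \<inter> A) \<and> Q (\<lambda>i\<in>T. x i - A)}
     ({y \<in> T \<rightarrow>\<^sub>E Pow A. P y} \<times> {z \<in> T \<rightarrow>\<^sub>E Pow (V - A). Q z})"
  proof (rule bij_betw_byWitness[where f' = ?g])
    have inv: "(\<lambda>i\<in>T. (\<lambda>i\<in>T. y i \<union> z i) i \<inter> A) = y" "(\<lambda>i\<in>T. (\<lambda>i\<in>T. y i \<union> z i) i - A) = z"
      if "y \<in> T \<rightarrow>\<^sub>E Pow A" "z \<in> T \<rightarrow>\<^sub>E Pow (V - A)" for y z
    proof -
      have sub: "y i \<subseteq> A" "z i \<subseteq> V - A" if "i \<in> T" for i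
        using PiE_mem[OF \<open>y \<in> _\<close> that] PiE_mem[OF \<open>z \<in> _\<close> that] by auto
      show "(\<lambda>i\<in>T. (\<lambda>i\<in>T. y i \<union> z i) i \<inter> A) = y"
        by (rule extensionalityI[of _ T]) (use that sub in \<open>auto simp: PiE_def\<close>)
      show "(\<lambda>i\<in>T. (\<lambda>i\<in>T. y i \<union> z i) i - A) = z"
        by (rule extensionalityI[of _ T]) (use that sub in \<open>auto simp: PiE_def\<close>)
    qed
    show "\<forall>w\<in>{y \<in> T \<rightarrow>\<^sub>E Pow A. P y} \<times> {z \<in> T \<rightarrow>\<^sub>E Pow (V - A). Q z}. ?f (?g w) = w"
      using inv by auto
    show "?g ` ({y \<in> T \<rightarrow>\<^sub>E Pow A. P y} \<times> {z \<in> T \<rightarrow>\<^sub>E Pow (V - A). Q z})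
        \<subseteq> {x \<in> T \<rightarrow>\<^sub>E Pow V. P (\<lambda>i\<in>T. x i \<inter> A) \<and> Q (\<lambda>i\<in>T. x i - A)}"
    proof (rule image_subsetI)
      fix w assume "w \<in> {y \<in> T \<rightarrow>\<^sub>E Pow A. P y} \<times> {z \<in> T \<rightarrow>\<^sub>E Pow (V - A). Q z}"
      then obtain y z where w: "w = (y, z)" and yz: "y \<in> T \<rightarrow>\<^sub>E Pow A" "P y" "z \<in> T \<rightarrow>\<^sub>E Pow (V - A)" "Q z"
        by auto
      have "(\<lambda>i\<in>T. y i \<union> z i) \<in> T \<rightarrow>\<^sub>E Pow V"
        using PiE_mem[OF yz(1)] PiE_mem[OF yz(3)] assms by fastforce
      then show "?g w \<in> {x \<in> T \<rightarrow>\<^sub>E Pow V. P (\<lambda>i\<in>T. x i \<inter> A) \<and> Q (\<lambda>i\<in>T. x i - A)}"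
        using inv[OF yz(1,3)] yz unfolding w by simp
    qed
    show "\<forall>x\<in>{x \<in> T \<rightarrow>\<^sub>E Pow V. P (\<lambda>i\<in>T. x i \<inter> A) \<and> Q (\<lambda>i\<in>T. x i - A)}. ?g (?f x) = x"
      by (auto intro!: extensionalityI[of _ T] simp: PiE_def)
    show "?f ` {x \<in> T \<rightarrow>\<^sub>E Pow V. P (\<lambda>i\<in>T. x i \<inter> A) \<and> Q (\<lambda>i\<in>T. x i - A)}
        \<subseteq> {y \<in> T \<rightarrow>\<^sub>E Pow A. P y} \<times> {z \<in> T \<rightarrow>\<^sub>E Pow (V - A). Q z}"
      by (fastforce dest: PiE_mem)
  qed
  from bij_betw_same_card[OF this] show ?thesis
    by (simp only: card_cartesian_product)
qed

text \<open>Traces on \<open>A\<close> and traces off \<open>A\<close> are independent: by four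
  instances of the splitting, both sides equal \<open>?a * ?b * ?M * ?N\<close>.\<close>

lemma tuples_split_independent:
  assumes "A \<subseteq> V"
  shows "card {x \<in> T \<rightarrow>\<^sub>E Pow V. P (\<lambda>i\<in>T. x i \<inter> A) \<and> Q (\<lambda>i\<in>T. x i - A)} * card (T \<rightarrow>\<^sub>E Pow V)
    = card {x \<in> T \<rightarrow>\<^sub>E Pow V. P (\<lambda>i\<in>T. x i \<inter> A)} * card {x \<in> T \<rightarrow>\<^sub>E Pow V. Q (\<lambda>i\<in>T. x i - A)}"
proof -
  let ?a = "card {y \<in> T \<rightarrow>\<^sub>E Pow A. P y}" and ?b = "card {z \<in> T \<rightarrow>\<^sub>E Pow (V - A). Q z}"
  let ?M = "card (T \<rightarrow>\<^sub>E Pow A)" and ?N = "card (T \<rightarrow>\<^sub>E Pow (V - A))"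
  have "card {x \<in> T \<rightarrow>\<^sub>E Pow V. P (\<lambda>i\<in>T. x i \<inter> A) \<and> Q (\<lambda>i\<in>T. x i - A)} = ?a * ?b"
    by (rule card_tuples_split[OF assms])
  moreover have "card {x \<in> T \<rightarrow>\<^sub>E Pow V. P (\<lambda>i\<in>T. x i \<inter> A)} = ?a * ?N"
    using card_tuples_split[OF assms, of T P "\<lambda>_. True"] by (simp only: simp_thms Collect_mem_eq)
  moreover have "card {x \<in> T \<rightarrow>\<^sub>E Pow V. Q (\<lambda>i\<in>T. x i - A)} = ?M * ?b"
    using card_tuples_split[OF assms, of T "\<lambda>_. True" Q] by (simp only: simp_thms Collect_mem_eq)
  moreover have "card (T \<rightarrow>\<^sub>E Pow V) = ?M * ?N"
    using card_tuples_split[OF assms, of T "\<lambda>_. True" "\<lambda>_. True"] by (simp only: simp_thms Collect_mem_eq)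
  ultimately show ?thesis by (simp only: mult_ac)
qed

text \<open>The trace on \<open>A\<close> of a uniform subset of \<open>V\<close> is uniform on
  \<open>Pow A\<close>, and the coordinates are independent, so the single probabilities
  multiply.\<close>

lemma card_tuples_all:
  assumes "finite T" "finite V" "A \<subseteq> V"
  shows "real (card {x \<in> T \<rightarrow>\<^sub>E Pow V. \<forall>i\<in>T. P (x i \<inter> A)})
    = (real (card {X. X \<subseteq> A \<and> P X}) / 2 ^ card A) ^ card T * real (card (T \<rightarrow>\<^sub>E Pow V))"
proof -
  have finA: "finite A" using assms finite_subset by blast
  have "{x \<in> T \<rightarrow>\<^sub>E Pow V. \<forall>i\<in>T. P (x i \<inter> A)} = {x \<in> T \<rightarrow>\<^sub>E Pow V. (\<lambda>y. \<forall>i\<in>T. P (y i)) (\<lambda>i\<in>T. x i \<inter> A) \<and> (\<lambda>_. True) (\<lambda>i\<in>T. x i - A)}"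
    by auto
  then have "card {x \<in> T \<rightarrow>\<^sub>E Pow V. \<forall>i\<in>T. P (x i \<inter> A)}
      = card {y \<in> T \<rightarrow>\<^sub>E Pow A. \<forall>i\<in>T. P (y i)} * card {z \<in> T \<rightarrow>\<^sub>E Pow (V - A). True}"
    using card_tuples_split[OF assms(3), of T "\<lambda>y. \<forall>i\<in>T. P (y i)" "\<lambda>_. True"] by simp
  moreover have "{y \<in> T \<rightarrow>\<^sub>E Pow A. \<forall>i\<in>T. P (y i)} = T \<rightarrow>\<^sub>E {X. X \<subseteq> A \<and> P X}"
    unfolding PiE_iff set_eq_iff by auto
  moreover have "card (T \<rightarrow>\<^sub>E Pow V) = card (T \<rightarrow>\<^sub>E Pow A) * card (T \<rightarrow>\<^sub>E Pow (V - A))"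
    using card_tuples_split[OF assms(3), of T "\<lambda>_. True" "\<lambda>_. True"] by simp
  ultimately show ?thesis
    using assms(1) finA by (simp add: card_PiE card_Pow power_divide)
qed

section \<open>Central binomial probabilities\<close>

text \<open>If \<open>X\<close> meets a \<open>k\<close>-element set \<open>A\<close> in
  \<open>j\<close> elements, then \<open>2 * j - k\<close> is the size of
  \<open>A \<inter> X\<close> minus that of \<open>A - X\<close>.\<close>

definition balanced :: "nat \<Rightarrow> nat \<Rightarrow> bool" where
  "balanced k j \<longleftrightarrow> 2 * int j - int k \<in> {-1, 0, 1}"

text \<open>The set \<open>{..<k}\<close> stands for any \<open>k\<close>-element set: the count
  depends only on the size, by \<open>card_balanced_subsets\<close>.\<close>

definition split_prob :: "nat \<Rightarrow> real" where
  "split_prob k = real (card {X. X \<subseteq> {..<k} \<and> balanced k (card X)}) / 2 ^ k"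

lemma card_balanced_subsets:
  assumes "finite A"
  shows "card {X. X \<subseteq> A \<and> balanced (card A) (card X)}
    = (if even (card A) then card A choose (card A div 2) else 2 * (card A choose (card A div 2)))"
proof (cases "even (card A)")
  case True
  then have "balanced (card A) j \<longleftrightarrow> j = card A div 2" for j
    unfolding balanced_def by auto
  then show ?thesis using True n_subsets[OF assms] by simp
next
  case False
  let ?m = "card A div 2"
  have k: "card A = 2 * ?m + 1" using False by presburger
  have "balanced (card A) j \<longleftrightarrow> j = ?m \<or> j = Suc ?m" for j
    unfolding balanced_def using False by (auto, presburger+)
  then have "{X. X \<subseteq> A \<and> balanced (card A) (card X)}
      = {X. X \<subseteq> A \<and> card X = ?m} \<union> {X. X \<subseteq> A \<and> card X = Suc ?m}" by auto
  moreover have "card ({X. X \<subseteq> A \<and> card X = ?m} \<union> {X. X \<subseteq> A \<and> card X = Suc ?m})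
     = (card A choose ?m) + (card A choose Suc ?m)"
    using assms by (subst card_Un_disjoint) (auto simp: n_subsets)
  moreover have "card A choose Suc ?m = card A choose ?m"
    by (subst binomial_symmetric) (use k in \<open>auto intro: arg_cong[where f = "\<lambda>j. card A choose j"]\<close>)
  ultimately show ?thesis using False by simp
qed

text \<open>Two absorption identities, linked through \<open>2 * m + 1 choose m\<close>.\<close>

lemma central_binomial_Suc:
  "(real m + 1) * real (2 * Suc m choose Suc m) = 2 * (2 * real m + 1) * real (2 * m choose m)"
proof -
  have a: "Suc m * (2 * Suc m choose Suc m) = 2 * Suc m * (2 * m + 1 choose m)"
    using Suc_times_binomial_eq[of "2 * m + 1" m] by (simp add: mult_ac)
  have b: "Suc m * (2 * m + 1 choose m) = (2 * m + 1) * (2 * m choose m)"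
    using Suc_times_binomial_eq[of "2 * m" m] binomial_symmetric[of m "2 * m + 1"]
    by (simp add: mult_ac)
  have "Suc m * (2 * Suc m choose Suc m) = 2 * ((2 * m + 1) * (2 * m choose m))"
    using a b by (metis mult.assoc)
  then have "real (Suc m * (2 * Suc m choose Suc m)) = real (2 * ((2 * m + 1) * (2 * m choose m)))"
    by presburger
  then show ?thesis by (simp add: algebra_simps)
qed

definition central_prob :: "nat \<Rightarrow> real" where
  "central_prob m = real (2 * m choose m) / 4 ^ m"

lemma central_prob_pos: "0 < central_prob m"
  by (simp add: central_prob_def)

lemma central_prob_Suc: "central_prob (Suc m) = (2 * real m + 1) / (2 * (real m + 1)) * central_prob m"
proof -
  have eq: "real (2 * Suc m choose Suc m) = 2 * (2 * real m + 1) * real (2 * m choose m) / (real m + 1)"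
    using central_binomial_Suc[of m] by (simp only: eq_divide_eq mult.commute) auto
  show ?thesis unfolding central_prob_def eq by (simp add: divide_simps) (simp add: algebra_simps)
qed

text \<open>The sequence \<open>m * (central_prob m)\<^sup>2\<close> increases, so any of its values is a lower bound for the later ones.\<close>

lemma central_prob_sq_mono:
  assumes "m \<le> m'"
  shows "real m * (central_prob m)\<^sup>2 \<le> real m' * (central_prob m')\<^sup>2"
  using assms
proof (induction m' rule: dec_induct)
  case base
  then show ?case by simp
next
  case (step m)
  have "real (Suc m) * (central_prob (Suc m))\<^sup>2
      = (2 * real m + 1)\<^sup>2 / (4 * (real m + 1)) * (central_prob m)\<^sup>2"
    unfolding central_prob_Suc power_mult_distrib power_divide
    by (simp add: divide_simps) (simp add: power2_eq_square algebra_simps)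
  \<comment> \<open>This is \<open>4 * m * (m + 1) \<le> (2 * m + 1)\<^sup>2\<close>.\<close>
  moreover have "real m \<le> (2 * real m + 1)\<^sup>2 / (4 * (real m + 1))"
    by (simp add: field_simps power2_eq_square)
  ultimately have "real m * (central_prob m)\<^sup>2 \<le> real (Suc m) * (central_prob (Suc m))\<^sup>2"
    by (simp only: mult_right_mono zero_le_power2)
  with step.IH show ?case by linarith
qed

lemma split_prob_even: "split_prob (2 * m) = central_prob m"
  using card_balanced_subsets[of "{..<2 * m}"]
  by (simp add: split_prob_def central_prob_def power_mult)

text \<open>Pascal's rule and symmetry make the central coefficient of row \<open>2 * m + 2\<close>
  twice a middle one of row \<open>2 * m + 1\<close>.\<close>

lemma split_prob_odd: "split_prob (2 * m + 1) = 2 * central_prob (Suc m)"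
proof -
  have "2 * Suc m choose Suc m = 2 * (2 * m + 1 choose m)"
    using binomial_symmetric[of m "2 * m + 1"] by simp
  then have "central_prob (Suc m) = real (2 * m + 1 choose m) / (2 * 4 ^ m)"
    unfolding central_prob_def by simp
  then show ?thesis
    using card_balanced_subsets[of "{..<2 * m + 1}"] by (simp add: split_prob_def power_mult)
qed

text \<open>The constant comes from \<open>m = 2\<close>, where
  \<open>2 * m * (central_prob m)\<^sup>2 = 9 / 16\<close>. It fails for
  \<open>m = 1\<close>.\<close>

lemma split_prob_even_ge:
  assumes "2 \<le> m"
  shows "0.75 / sqrt (real (2 * m)) \<le> split_prob (2 * m)"
proof -
  have "central_prob 2 = 3 / 8" by (simp add: central_prob_def numeral_eq_Suc)
  then have "9 / 32 \<le> real m * (central_prob m)\<^sup>2"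
    using central_prob_sq_mono[OF assms] by (simp only:) (simp add: power_divide)
  then have "(0.75 / sqrt (real (2 * m)))\<^sup>2 \<le> (central_prob m)\<^sup>2"
    using assms by (simp add: power_divide field_simps)
  then show ?thesis
    unfolding split_prob_even by (rule power2_le_imp_le) (simp add: central_prob_pos less_imp_le)
qed

text \<open>Here the start value at \<open>m = 1\<close> suffices, with
  \<open>m + 1 \<le> 2 * m + 1\<close> to spare.\<close>

lemma split_prob_odd_ge: "1 / sqrt (real (2 * m + 1)) \<le> split_prob (2 * m + 1)"
proof -
  have "central_prob 1 = 1 / 2" by (simp add: central_prob_def)
  then have "1 / 4 \<le> real (Suc m) * (central_prob (Suc m))\<^sup>2"
    using central_prob_sq_mono[of 1 "Suc m"] by (simp only:) (simp add: power_divide)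
  then have "1 / real (Suc m) \<le> (2 * central_prob (Suc m))\<^sup>2"
    unfolding power_mult_distrib by (simp add: field_simps)
  moreover have "(1 / sqrt (real (2 * m + 1)))\<^sup>2 \<le> 1 / real (Suc m)"
    by (simp add: power_divide field_simps)
  ultimately have "(1 / sqrt (real (2 * m + 1)))\<^sup>2 \<le> (2 * central_prob (Suc m))\<^sup>2" by linarith
  then show ?thesis
    unfolding split_prob_odd by (rule power2_le_imp_le) (simp add: central_prob_pos less_imp_le)
qed

lemma split_prob_pos: "0 < split_prob k"
proof (cases "even k")
  case True
  then obtain m where "k = 2 * m" by (auto elim: evenE)
  then show ?thesis by (simp only: split_prob_even central_prob_pos)
next
  case False
  then obtain m where "k = 2 * m + 1" by (auto elim: oddE)
  then show ?thesis using central_prob_pos[of "Suc m"] by (simp only: split_prob_odd)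
qed

lemma card_unbalanced_subsets:
  assumes "finite A"
  shows "real (card {X. X \<subseteq> A \<and> \<not> balanced (card A) (card X)}) / 2 ^ card A = 1 - split_prob (card A)"
proof -
  let ?B = "{X. X \<subseteq> A \<and> balanced (card A) (card X)}"
  have "{X. X \<subseteq> A \<and> \<not> balanced (card A) (card X)} = Pow A - ?B" by auto
  moreover have "card (Pow A - ?B) = card (Pow A) - card ?B"
    using assms by (intro card_Diff_subset) auto
  moreover have "card ?B \<le> card (Pow A)"
    using assms by (intro card_mono) auto
  moreover have "card ?B = card {X. X \<subseteq> {..<card A} \<and> balanced (card A) (card X)}"
    using card_balanced_subsets[OF assms] card_balanced_subsets[of "{..<card A}"] by simp
  ultimately show ?thesis
    using assms by (simp add: split_prob_def card_Pow of_nat_diff diff_divide_distrib)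
qed

lemma split_prob_le_1: "split_prob k \<le> 1"
proof -
  have "0 \<le> real (card {X. X \<subseteq> {..<k} \<and> \<not> balanced (card {..<k}) (card X)}) / 2 ^ card {..<k}"
    by simp
  then show ?thesis unfolding card_unbalanced_subsets[OF finite_lessThan] by simp
qed

section \<open>Estimates\<close>

text \<open>The exponent truncates the series of \<open>- ln (1 - p)\<close> after two terms; the
  remainder has derivative \<open>u\<^sup>2 / (1 - u)\<close>.\<close>

lemma one_minus_le_exp_quadratic:
  fixes p :: real
  assumes "0 \<le> p" "p \<le> 1"
  shows "1 - p \<le> exp (- (p + p\<^sup>2 / 2))"
proof (cases "p = 1")
  case False
  let ?f = "\<lambda>u::real. - ln (1 - u) - u - u\<^sup>2 / 2"
  have "?f 0 \<le> ?f p"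
  proof (rule DERIV_nonneg_imp_nondecreasing[OF assms(1)])
    fix u :: real assume u: "0 \<le> u" "u \<le> p"
    then have "u < 1" using assms False by simp
    then have "(?f has_real_derivative u\<^sup>2 / (1 - u)) (at u)"
      by (auto intro!: derivative_eq_intros simp: field_simps power2_eq_square)
    moreover have "0 \<le> u\<^sup>2 / (1 - u)" using \<open>u < 1\<close> by simp
    ultimately show "\<exists>y. (?f has_real_derivative y) (at u) \<and> 0 \<le> y" by blast
  qed
  then have "ln (1 - p) \<le> - (p + p\<^sup>2 / 2)" by simp
  then show ?thesis using assms False
    by (metis diff_gt_0_iff_gt exp_le_cancel_iff exp_ln order_le_imp_less_or_eq)
qed simp

lemma ln_2_ge_two_thirds: "2 / 3 \<le> ln (2 :: real)"
proof -
  \<comment> \<open>The number 0.2925 lies just below \<open>1 - 1 / sqrt 2\<close>, and twice its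
    quadratic exponent still exceeds 2/3.\<close>
  have "(1 / 2 :: real) \<le> (1 - 0.2925)\<^sup>2" by (simp add: power2_eq_square)
  also have "\<dots> \<le> (exp (- (0.2925 + 0.2925\<^sup>2 / 2)))\<^sup>2"
    by (intro power_mono one_minus_le_exp_quadratic) auto
  also have "\<dots> = exp (- (2 * (0.2925 + 0.2925\<^sup>2 / 2)))"
    by (simp only: exp_double[symmetric] mult_minus_right)
  also have "\<dots> \<le> exp (- (2 / 3))" by (simp add: power2_eq_square)
  finally have "exp (2 / 3) \<le> (2 :: real)" by (simp add: exp_minus field_simps)
  then show ?thesis by (subst ln_ge_iff) simp_all
qed

text \<open>The reciprocal of \<open>(1 + 1 / d) ^ d \<le> exp 1\<close>. It bounds the factor
  \<open>(1 - x) ^ d\<close> of the local lemma at \<open>x = 1 / (d + 1)\<close>.\<close>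

lemma exp_neg_1_le_power: "exp (- 1) \<le> (1 - 1 / (real d + 1)) ^ d"
proof (cases "d = 0")
  case False
  have "1 + 1 / real d \<le> exp (1 / real d)" by (rule exp_ge_add_one_self)
  then have "(1 + 1 / real d) ^ d \<le> exp (1 / real d) ^ d" by (rule power_mono) simp
  also have "\<dots> = exp 1" using False by (simp add: exp_of_nat_mult[symmetric])
  finally have "inverse (exp 1) \<le> inverse ((1 + 1 / real d) ^ d)"
    by (intro le_imp_inverse_le) (auto simp: add_pos_nonneg)
  also have "\<dots> = (1 - 1 / (real d + 1)) ^ d"
    using False by (simp add: power_inverse[symmetric] field_simps)
  finally show ?thesis by (simp add: exp_minus)
qed simp

text \<open>\<open>L\<close> will be \<open>ln (d + 1) + 1\<close>, which is at least 5/3 once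
  \<open>d \<ge> 1\<close>. The hypothesis on \<open>t\<close> allows for rounding down, so each
  case must gain enough over the rate \<open>0.67 / sqrt k\<close> to pay for one lost
  trial.\<close>

lemma split_failure_le:
  fixes L :: real and t :: nat
  assumes k: "0 < k" and L: "5 / 3 \<le> L" and t: "sqrt (real k) / 0.67 * L - 1 < real t"
  shows "(1 - split_prob k) ^ t \<le> exp (- L)"
proof -
  define s where "s = sqrt (real k)"
  have s: "1 \<le> s" using k by (simp add: s_def)
  have t': "s / 0.67 * L - 1 < real t" using t by (simp add: s_def)
  have p: "0 \<le> 1 - split_prob k" using split_prob_le_1[of k] by simp
  have main: "(1 - split_prob k) ^ t \<le> exp (- L)"
    if "1 - split_prob k \<le> exp (- r)" "0 \<le> r" "L \<le> r * (s / 0.67 * L - 1)" for r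
  proof -
    have "L \<le> r * real t"
      using that(3) mult_left_mono[OF less_imp_le[OF t'] that(2)] by linarith
    have "(1 - split_prob k) ^ t \<le> exp (- r) ^ t"
      using that(1) p by (rule power_mono)
    also have "\<dots> = exp (- (r * real t))" by (simp add: exp_of_nat_mult[symmetric] mult_ac)
    also have "\<dots> \<le> exp (- L)" using \<open>L \<le> r * real t\<close> by simp
    finally show ?thesis .
  qed
  consider "k = 1" | "k = 2" | m where "k = 2 * m" "2 \<le> m" | m where "k = 2 * m + 1" "1 \<le> m"
  proof (cases "even k")
    case True
    then obtain m where "k = 2 * m" by (auto elim: evenE)
    then show ?thesis using that k by (cases "m = 1") auto
  next
    case False
    then obtain m where "k = 2 * m + 1" by (auto elim: oddE)
    then show ?thesis using that by (cases "m = 0") auto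
  qed
  then show ?thesis
  proof cases
    case 1
    have "split_prob 1 = 1" using split_prob_odd[of 0] by (simp add: central_prob_def)
    \<comment> \<open>Failure is impossible here, but \<open>0 ^ 0 = 1\<close>, so one trial is
      required.\<close>
    moreover have "0 < t" using t L 1 by (cases t) auto
    ultimately show ?thesis using 1 by (simp add: power_0_left)
  next
    case 2
    have "split_prob 2 = 1 / 2" using split_prob_even[of 1] by (simp add: central_prob_def)
    \<comment> \<open>The failure probability is exactly 1/2, hence the rate \<open>ln 2\<close>.
      With 1.414 for \<open>sqrt 2\<close> and 2/3 for \<open>ln 2\<close> the inequality already
      holds at \<open>L = 5 / 3\<close>.\<close>
    moreover have "L \<le> ln 2 * (s / 0.67 * L - 1)"
    proof -
      have "1.414 \<le> s" unfolding s_def 2 by (rule real_le_rsqrt) (simp add: power2_eq_square)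
      then have "1.414 / 0.67 * L - 1 \<le> s / 0.67 * L - 1" using L by (simp add: field_simps)
      moreover have "0 \<le> 1.414 / 0.67 * L - 1" using L by simp
      ultimately have "2 / 3 * (1.414 / 0.67 * L - 1) \<le> ln 2 * (s / 0.67 * L - 1)"
        using ln_2_ge_two_thirds by (intro mult_mono) auto
      moreover have "L \<le> 2 / 3 * (1.414 / 0.67 * L - 1)" using L by (simp add: field_simps)
      ultimately show ?thesis by linarith
    qed
    ultimately show ?thesis using 2 by (intro main[of "ln 2"]) (auto simp: exp_minus)
  next
    case 3
    define q where "q = 0.75 / s"
    have q: "0 \<le> q" "q \<le> split_prob k"
      using split_prob_even_ge[OF 3(2)] s by (auto simp: q_def s_def 3(1))
    have "1 - split_prob k \<le> 1 - q" using q by simp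
    also have "\<dots> \<le> exp (- (q + q\<^sup>2 / 2))"
      using q split_prob_le_1[of k] by (intro one_minus_le_exp_quadratic) auto
    finally have "1 - split_prob k \<le> exp (- (q + q\<^sup>2 / 2))" .
    \<comment> \<open>Since \<open>q * s = 0.75\<close>, the linear part of the rate gives
      \<open>75 / 67 * L - q\<close>. The surplus \<open>8 / 67 * L\<close> alone does not cover
      \<open>q = 3 / 8\<close> at \<open>L = 5 / 3\<close>; the term in \<open>q * L\<close> from
      the quadratic part makes up for it.\<close>
    moreover have "L \<le> (q + q\<^sup>2 / 2) * (s / 0.67 * L - 1)"
    proof -
      have s2: "2 \<le> s" unfolding s_def 3(1) using 3(2) by (intro real_le_rsqrt) simp
      have qs: "q \<le> 3 / 8" using s2 by (simp add: q_def field_simps)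
      have eq: "(q + q\<^sup>2 / 2) * (s / 0.67 * L - 1) = (1 + q / 2) * (0.75 / 0.67 * L - q)"
      proof -
        have "q * s = 0.75" using s by (simp add: q_def)
        have "(q + q\<^sup>2 / 2) * (s / 0.67 * L - 1) = (1 + q / 2) * (q * s / 0.67 * L - q)"
          by (simp add: algebra_simps power2_eq_square)
        then show ?thesis unfolding \<open>q * s = 0.75\<close> .
      qed
      have "q * (5 / 3) \<le> q * L" using q L by (intro mult_left_mono) auto
      moreover have "q * q \<le> 3 / 8 * q" using q qs by (intro mult_right_mono) auto
      moreover have "(1 + q / 2) * (0.75 / 0.67 * L - q)
          = 75 / 67 * L - q + 75 / 134 * (q * L) - 1 / 2 * (q * q)"
        by (simp add: algebra_simps)
      ultimately show ?thesis unfolding eq using L q qs by linarith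
    qed
    ultimately show ?thesis using q by (intro main) auto
  next
    case 4
    define q where "q = 1 / s"
    have q: "0 \<le> q" "q \<le> split_prob k"
      using split_prob_odd_ge[of m] s by (auto simp: q_def s_def 4(1))
    have "1 - split_prob k \<le> exp (- q)"
      using q exp_ge_add_one_self[of "- q"] by simp
    \<comment> \<open>The linear rate is enough: the surplus \<open>33 / 67 * L\<close> is at least
      \<open>55 / 67\<close>, while \<open>q \<le> 2 / 3\<close>.\<close>
    moreover have "L \<le> q * (s / 0.67 * L - 1)"
    proof -
      have "1.5 \<le> s" unfolding s_def 4(1) using 4(2) by (intro real_le_rsqrt) (simp add: power2_eq_square)
      then have "q \<le> 2 / 3" by (simp add: q_def field_simps)
      moreover have "q * (s / 0.67 * L - 1) = L / 0.67 - q" using s by (simp add: q_def field_simps)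
      ultimately show ?thesis using L by simp
    qed
    ultimately show ?thesis using q by (intro main) auto
  qed
qed

section \<open>Secting families\<close>

lemma secting_number_le_card:
  assumes "F' \<subseteq> Pow {1..n}" "secting n D F F'"
  shows "secting_number n D F \<le> card F'"
  unfolding secting_number_def by (intro Least_le exI[of _ F'] conjI assms refl)

lemma secting_iff_balanced:
  assumes "F \<subseteq> {A. A \<subseteq> {1..n} \<and> card A = k}"
  shows "secting n {-1, 0, 1} F F' \<longleftrightarrow> (\<forall>A\<in>F. \<exists>X\<in>F'. balanced k (card (X \<inter> A)))"
proof -
  have "int (card (A \<inter> X)) - int (card (A \<inter> ({1..n} - X))) = 2 * int (card (X \<inter> A)) - int k"
    if "A \<in> F" for A X
  proof -
    have A: "A \<subseteq> {1..n}" "card A = k" using assms that by auto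
    then have fin: "finite A" using finite_subset by blast
    have "A \<inter> ({1..n} - X) = A - A \<inter> X" using A by auto
    moreover have "card (A - A \<inter> X) = k - card (A \<inter> X)"
      using fin A by (subst card_Diff_subset) auto
    moreover have "card (A \<inter> X) \<le> k" using fin A card_mono[of A "A \<inter> X"] by auto
    ultimately show ?thesis by (simp add: Int_commute of_nat_diff)
  qed
  then show ?thesis unfolding secting_def balanced_def by simp
qed

text \<open>The local lemma on \<open>t\<close>-tuples of subsets, where \<open>E A\<close> collects
  the tuples failing on \<open>A\<close>. The weight \<open>x\<close> stays free because
  \<open>d = 0\<close> and \<open>d > 0\<close> call for different choices.\<close>

lemma secting_number_le_of_local_lemma:
  fixes x :: real
  assumes F: "F \<subseteq> {A. A \<subseteq> {1..n} \<and> card A = k}"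
    and x: "0 \<le> x" "x < 1"
    and prob: "(1 - split_prob k) ^ t \<le> x * (1 - x) ^ dependency F"
  shows "secting_number n {-1, 0, 1} F \<le> t"
proof -
  define \<Omega> where "\<Omega> = {..<t} \<rightarrow>\<^sub>E Pow {1..n}"
  define E where "E A = {x \<in> \<Omega>. \<forall>i\<in>{..<t}. \<not> balanced k (card (x i \<inter> A))}" for A
  define nb where "nb A = {B \<in> F. B \<noteq> A \<and> card (A \<inter> B) \<ge> 1}" for A
  have finF: "finite F" by (rule finite_subset[OF F]) simp
  have "\<Omega> - \<Union>(E ` F) \<noteq> {}"
  proof (rule local_lemma_uniform[where nb = nb and d = "dependency F" and x = x])
    show "finite \<Omega>" unfolding \<Omega>_def by (intro finite_PiE) auto
    show "\<Omega> \<noteq> {}" unfolding \<Omega>_def by (auto simp: PiE_eq_empty_iff)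
    show "card (F \<inter> nb A) \<le> dependency F" if "A \<in> F" for A
    proof -
      have "F \<inter> nb A = nb A" by (auto simp: nb_def)
      moreover have "card (nb A) = set_dependency F A" by (simp add: nb_def set_dependency_def)
      moreover have "set_dependency F A \<le> dependency F"
        using that finF by (auto simp: dependency_def)
      ultimately show ?thesis by simp
    qed
    show "real (card (E A)) \<le> x * (1 - x) ^ dependency F * real (card \<Omega>)" if "A \<in> F" for A
    proof -
      have A: "A \<subseteq> {1..n}" "card A = k" using F that by auto
      then have "finite A" using finite_subset by blast
      then have "real (card (E A)) = (1 - split_prob k) ^ t * real (card \<Omega>)"
        unfolding E_def \<Omega>_def
        using card_tuples_all[of "{..<t}" "{1..n}" A "\<lambda>X. \<not> balanced k (card X)"] A
          card_unbalanced_subsets[of A] by simp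
      also have "\<dots> \<le> x * (1 - x) ^ dependency F * real (card \<Omega>)"
        using prob by (intro mult_right_mono) auto
      finally show ?thesis .
    qed
    \<comment> \<open>Members of \<open>S\<close> are disjoint from \<open>A\<close>, so their
      events depend only on the parts \<open>x i - A\<close>, whereas \<open>E A\<close> depends
      only on \<open>x i \<inter> A\<close>.\<close>
    show "card (E A \<inter> (\<Omega> - \<Union>(E ` S))) * card \<Omega> = card (E A) * card (\<Omega> - \<Union>(E ` S))"
      if A: "A \<in> F" and S: "S \<subseteq> F - insert A (nb A)" for A S
    proof -
      have AV: "A \<subseteq> {1..n}" using F A by auto
      let ?P = "\<lambda>y. \<forall>i\<in>{..<t}. \<not> balanced k (card (y i))"
      let ?Q = "\<lambda>z. \<forall>B\<in>S. \<exists>i\<in>{..<t}. balanced k (card (z i \<inter> B))"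
      have disj: "A \<inter> B = {}" if "B \<in> S" for B
      proof -
        have "card (A \<inter> B) = 0" using S that by (auto simp: nb_def)
        moreover have "finite (A \<inter> B)" using AV finite_subset by blast
        ultimately show ?thesis by simp
      qed
      then have "(y - A) \<inter> B = y \<inter> B" if "B \<in> S" for B y using that by blast
      then have Q: "\<Omega> - \<Union>(E ` S) = {x \<in> \<Omega>. ?Q (\<lambda>i\<in>{..<t}. x i - A)}"
        unfolding E_def by auto
      have P: "E A = {x \<in> \<Omega>. ?P (\<lambda>i\<in>{..<t}. x i \<inter> A)}"
        unfolding E_def by auto
      have "E A \<inter> (\<Omega> - \<Union>(E ` S)) = {x \<in> \<Omega>. ?P (\<lambda>i\<in>{..<t}. x i \<inter> A) \<and> ?Q (\<lambda>i\<in>{..<t}. x i - A)}"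
        unfolding P Q by blast
      then show ?thesis
        unfolding Q unfolding P \<Omega>_def
        using tuples_split_independent[OF AV, of "{..<t}" ?P ?Q] by simp
    qed
  qed (use finF x in auto)
  then obtain y where y: "y \<in> \<Omega>" "\<And>A. A \<in> F \<Longrightarrow> y \<notin> E A" by blast
  let ?F' = "y ` {..<t}"
  have "?F' \<subseteq> Pow {1..n}" using y(1) unfolding \<Omega>_def by (auto dest: PiE_mem)
  moreover have "secting n {-1, 0, 1} F ?F'"
    unfolding secting_iff_balanced[OF F] using y by (auto simp: E_def)
  ultimately have "secting_number n {-1, 0, 1} F \<le> card ?F'" by (rule secting_number_le_card)
  \<comment> \<open>Coordinates of \<open>y\<close> may coincide, hence only an inequality.\<close>
  also have "\<dots> \<le> t" using card_image_le[of "{..<t}" y] by simp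
  finally show ?thesis .
qed

theorem theorem6:
  fixes n k d :: nat and F :: "nat set set"
  assumes "n > 0" and "k > 0" and "k \<le> n"
    and "F \<subseteq> {A. A \<subseteq> {1..n} \<and> card A = k}"
    and "dependency F = d"
  shows "real (secting_number n {-1, 0, 1} F) \<le> sqrt (real k) / 0.67 * (ln (real d + 1) + 1)"
proof -
  define L where "L = ln (real d + 1) + 1"
  define t where "t = nat \<lfloor>sqrt (real k) / 0.67 * L\<rfloor>"
  have L1: "1 \<le> L" by (simp add: L_def)
  have "1 \<le> sqrt (real k)" using assms(2) by simp
  then have "0.67 \<le> sqrt (real k)" by (rule order_trans[rotated]) simp
  then have "1 \<le> sqrt (real k) / 0.67" by simp
  from mult_mono[OF this L1] have "1 \<le> sqrt (real k) / 0.67 * L" by simp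
  then have t: "real t \<le> sqrt (real k) / 0.67 * L" "sqrt (real k) / 0.67 * L - 1 < real t" "1 \<le> t"
    unfolding t_def by linarith+
  have "secting_number n {-1, 0, 1} F \<le> t"
  proof (cases "d = 0")
    case True
    \<comment> \<open>For \<open>d = 0\<close> the weight \<open>1 - split_prob k\<close> works: the
      requirement becomes \<open>(1 - split_prob k) ^ t \<le> 1 - split_prob k\<close>, true as
      \<open>t \<ge> 1\<close>.\<close>
    have "0 \<le> 1 - split_prob k" "1 - split_prob k < 1"
      using split_prob_pos[of k] split_prob_le_1[of k] by auto
    then show ?thesis
      using t(3) power_decreasing[of 1 t "1 - split_prob k"] True assms(5)
      by (intro secting_number_le_of_local_lemma[OF assms(4), of "1 - split_prob k"]) auto
  next
    case False
    have "ln 2 \<le> ln (real d + 1)" using False by (subst ln_le_cancel_iff) auto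
    then have "5 / 3 \<le> L" using ln_2_ge_two_thirds unfolding L_def by linarith
    then have "(1 - split_prob k) ^ t \<le> exp (- L)"
      using assms(2) t(2) by (intro split_failure_le)
    \<comment> \<open>The two factors match \<open>x * (1 - x) ^ d\<close> at
      \<open>x = 1 / (d + 1)\<close>; the summand 1 in \<open>L\<close> supplies
      \<open>exp (- 1)\<close>.\<close>
    also have "\<dots> = 1 / (real d + 1) * exp (- 1)"
      by (simp add: L_def exp_diff exp_minus field_simps)
    also have "\<dots> \<le> 1 / (real d + 1) * (1 - 1 / (real d + 1)) ^ d"
      by (intro mult_left_mono exp_neg_1_le_power) auto
    finally show ?thesis
      using False assms(5)
      by (intro secting_number_le_of_local_lemma[OF assms(4), of "1 / (real d + 1)"]) auto
  qed
  then have "real (secting_number n {-1, 0, 1} F) \<le> real t" by simp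
  with t(1) show ?thesis by (simp add: L_def)
qed

end
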